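(* Let $n\in\omega$, $n\geq 2$. The following are equivalent for any topological space $X$: (a) for every open filter $\mathcal F$ on $X$, $|a\mathcal F|\geq n-1$; (b) for every $A\subseteq X$ with $|A|<n-1$ and for every family $\mathcal U$ of open subsets of $X$ such that $X\setminus A\subseteq\bigcup\mathcal U$, there exists a finite subfamily $\mathcal V\subseteq\mathcal U$ such that $X=\bigcup_{V\in\mathcal V}\overline V$; (c) $X$ is closed in every extension of $X$ that is $n$-Hausdorff except for $X$.
   Context: Spaces are arbitrary topological spaces (no separation axioms assumed). An open filter on $X$ is a nonempty family of nonempty open subsets of $X$ closed under finite intersections and under open supersets. The adherence of $\mathcal F$ is $a\mathcal F=\bigcap_{F\in\mathcal F}\mathrm{cl}_X(F)$. An extension of $X$ is a space $Y$ containing $X$ as a dense subspace. An extension $Y$ of $X$ is $n$-Hausdorff except for $X$ if for all $p\in Y\setminus X$ and $q_1,\dots,q_{n-1}\in Y$ with $p,q_1,\dots,q_{n-1}$ pairwise distinct, there are open sets $U,V_1,\dots,V_{n-1}$ in $Y$ with $p\in U$, $q_i\in V_i$ for $i=1,\dots,n-1$, and $U\cap V_1\cap\dots\cap V_{n-1}=\varnothing$. *)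

theory Defs
  imports "HOL-Analysis.Abstract_Topology"
begin

definition open_filter :: "'a topology \<Rightarrow> 'a set set \<Rightarrow> bool" where
  "open_filter X \<F> \<longleftrightarrow>
     \<F> \<noteq> {} \<and>
     (\<forall>F\<in>\<F>. openin X F \<and> F \<noteq> {}) \<and>
     (\<forall>F\<in>\<F>. \<forall>G\<in>\<F>. F \<inter> G \<in> \<F>) \<and>
     (\<forall>F\<in>\<F>. \<forall>G. openin X G \<and> F \<subseteq> G \<longrightarrow> G \<in> \<F>)"

definition adherence :: "'a topology \<Rightarrow> 'a set set \<Rightarrow> 'a set" where
  "adherence X \<F> = (\<Inter>F\<in>\<F>. X closure_of F)"

text \<open>The inclusion of \<open>X\<close> into an extension \<open>Y\<close> is an embedding \<open>e\<close>, so that the points of \<open>Y\<close>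
  may live in another type; \<open>e ` topspace X\<close> is the copy of \<open>X\<close> inside \<open>Y\<close>.\<close>

definition extension :: "'a topology \<Rightarrow> 'b topology \<Rightarrow> ('a \<Rightarrow> 'b) \<Rightarrow> bool" where
  "extension X Y e \<longleftrightarrow>
     embedding_map X Y e \<and> Y closure_of (e ` topspace X) = topspace Y"

definition n_Hausdorff_except :: "nat \<Rightarrow> 'b topology \<Rightarrow> 'b set \<Rightarrow> bool" where
  "n_Hausdorff_except n Y S \<longleftrightarrow>
     (\<forall>p q. p \<in> topspace Y - S \<and> (\<forall>i\<in>{1..n-1}. q i \<in> topspace Y \<and> q i \<noteq> p) \<and>
            inj_on q {1..n-1} \<longrightarrow>
        (\<exists>U V. openin Y U \<and> p \<in> U \<and>
               (\<forall>i\<in>{1..n-1}. openin Y (V i) \<and> q i \<in> V i) \<and>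
               U \<inter> (\<Inter>i\<in>{1..n-1}. V i) = {}))"

text \<open>HOL cannot quantify over types inside a formula, so ``\<open>X\<close> is closed in every extension that is
  \<open>n\<close>-Hausdorff except for \<open>X\<close>'' is relative to the type \<open>'b\<close> of the points of the extensions,
  and for a small \<open>'b\<close> it can hold vacuously. To express it for extensions of all types, a theorem
  should conclude it for an arbitrary type and assume it only for one specific type; \<open>'a option\<close>
  has room for all one-point extensions.\<close>

definition closed_in_extensions :: "'b itself \<Rightarrow> nat \<Rightarrow> 'a topology \<Rightarrow> bool" where
  "closed_in_extensions (_ :: 'b itself) n X \<longleftrightarrow>
     (\<forall>(Y :: 'b topology) e.
        extension X Y e \<and> n_Hausdorff_except n Y (e ` topspace X) \<longrightarrow>
        closedin Y (e ` topspace X))"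

end

theory Submission
  imports Defs
begin

text \<open>
  For (a) \<open>\<longleftrightarrow>\<close> (b), a family \<open>\<U>\<close> without a finite subfamily of dense union corresponds to the open
  filter generated by the complements of the closures of its members.
  For (a) \<open>\<longrightarrow>\<close> (c), a point \<open>p\<close> outside \<open>X\<close> traces an open filter on \<open>X\<close>; one passes to a maximal
  open filter above it, because an adherent point of a maximal open filter is a limit of it, so that
  neighbourhoods of \<open>p\<close> and of any finitely many adherent points meet simultaneously.
  For (c) \<open>\<longrightarrow>\<close> (a), one adds a point to \<open>X\<close> whose neighbourhood trace is a given open filter.
\<close>

section \<open>Open filters and their adherent points\<close>

lemma openin_open_filter: "open_filter X \<F> \<Longrightarrow> F \<in> \<F> \<Longrightarrow> openin X F"
  unfolding open_filter_def by blast

lemma nonempty_open_filter: "open_filter X \<F> \<Longrightarrow> F \<in> \<F> \<Longrightarrow> F \<noteq> {}"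
  unfolding open_filter_def by blast

lemma Int_open_filter: "open_filter X \<F> \<Longrightarrow> F \<in> \<F> \<Longrightarrow> G \<in> \<F> \<Longrightarrow> F \<inter> G \<in> \<F>"
  unfolding open_filter_def by blast

lemma superset_open_filter:
  "open_filter X \<F> \<Longrightarrow> F \<in> \<F> \<Longrightarrow> openin X G \<Longrightarrow> F \<subseteq> G \<Longrightarrow> G \<in> \<F>"
  unfolding open_filter_def by blast

lemma topspace_open_filter: "open_filter X \<F> \<Longrightarrow> topspace X \<in> \<F>"
  unfolding open_filter_def by (metis all_not_in_conv openin_subset openin_topspace)

lemma Inter_open_filter:
  assumes "open_filter X \<F>" "finite \<G>" "\<G> \<noteq> {}" "\<G> \<subseteq> \<F>"
  shows "\<Inter>\<G> \<in> \<F>"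
  using assms(2-4) by (induction rule: finite_ne_induct) (auto intro: Int_open_filter[OF assms(1)])

lemma adherence_subset_topspace:
  assumes "open_filter X \<F>"
  shows "adherence X \<F> \<subseteq> topspace X"
  using topspace_open_filter[OF assms] unfolding adherence_def by (force simp: in_closure_of)

lemma in_adherence:
  assumes "open_filter X \<F>"
  shows "x \<in> adherence X \<F> \<longleftrightarrow>
    x \<in> topspace X \<and> (\<forall>V F. openin X V \<and> x \<in> V \<and> F \<in> \<F> \<longrightarrow> V \<inter> F \<noteq> {})"
proof -
  have "x \<in> adherence X \<F> \<longleftrightarrow> x \<in> topspace X \<and> (\<forall>F\<in>\<F>. x \<in> X closure_of F)"
    using adherence_subset_topspace[OF assms] unfolding adherence_def by blast
  then show ?thesis unfolding in_closure_of by (metis IntE IntI all_not_in_conv)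
qed

section \<open>Maximal open filters\<close>

text \<open>Supplies the upper bounds for Zorn's lemma. The chain condition enters for
  intersections: any two sets of the union already lie in one common member of
  \<open>\<C>\<close>.\<close>

lemma open_filter_Union_chain:
  assumes "\<C> \<noteq> {}" "\<And>\<F>. \<F> \<in> \<C> \<Longrightarrow> open_filter X \<F>"
    and chain: "\<And>\<F> \<G>. \<F> \<in> \<C> \<Longrightarrow> \<G> \<in> \<C> \<Longrightarrow> \<F> \<subseteq> \<G> \<or> \<G> \<subseteq> \<F>"
  shows "open_filter X (\<Union>\<C>)"
proof -
  have "F \<inter> G \<in> \<Union>\<C>" if "F \<in> \<Union>\<C>" "G \<in> \<Union>\<C>" for F G
  proof -
    from that obtain \<F> \<G> where "\<F> \<in> \<C>" "F \<in> \<F>" "\<G> \<in> \<C>" "G \<in> \<G>" by blast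
    then obtain \<H> where "\<H> \<in> \<C>" "F \<in> \<H>" "G \<in> \<H>" using chain by blast
    then show ?thesis using assms(2) Int_open_filter by blast
  qed
  then show ?thesis
    unfolding open_filter_def[of X "\<Union>\<C>"]
  proof (intro conjI ballI allI impI)
    show "\<Union>\<C> \<noteq> {}"
      using assms(1,2) topspace_open_filter by blast
  next
    fix F assume "F \<in> \<Union>\<C>"
    then show "openin X F" "F \<noteq> {}"
      using assms(2) openin_open_filter nonempty_open_filter by (metis UnionE)+
  next
    fix F G assume "F \<in> \<Union>\<C>" "openin X G \<and> F \<subseteq> G"
    then show "G \<in> \<Union>\<C>"
      using assms(2) superset_open_filter by (metis UnionE UnionI)
  qed
qed

lemma maximal_open_filter_exists:
  assumes "open_filter X \<F>"
  obtains \<G> where "open_filter X \<G>" "\<F> \<subseteq> \<G>"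
    "\<And>\<H>. open_filter X \<H> \<Longrightarrow> \<G> \<subseteq> \<H> \<Longrightarrow> \<H> = \<G>"
proof -
  let ?S = "{\<G>. open_filter X \<G> \<and> \<F> \<subseteq> \<G>}"
  have "\<exists>\<G>\<in>?S. \<forall>\<H>\<in>?S. \<G> \<subseteq> \<H> \<longrightarrow> \<H> = \<G>"
  proof (rule subset_Zorn_nonempty)
    show "?S \<noteq> {}" using assms by blast
    fix \<C> assume "\<C> \<noteq> {}" "subset.chain ?S \<C>"
    then have "open_filter X (\<Union>\<C>)"
      by (intro open_filter_Union_chain) (auto simp: subset_chain_def)
    moreover have "\<F> \<subseteq> \<Union>\<C>"
      using \<open>\<C> \<noteq> {}\<close> \<open>subset.chain ?S \<C>\<close> unfolding subset_chain_def by blast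
    ultimately show "\<Union>\<C> \<in> ?S" by blast
  qed
  then obtain \<G> where "\<G> \<in> ?S" "\<forall>\<H>\<in>?S. \<G> \<subseteq> \<H> \<longrightarrow> \<H> = \<G>" by (rule bexE)
  then show ?thesis by (intro that[of \<G>]) auto
qed

text \<open>The sets \<open>V \<inter> F\<close> with \<open>F\<close> in \<open>\<F>\<close> are
  nonempty and generate an open filter \<open>?H\<close> that contains both \<open>V\<close> and
  \<open>\<F>\<close>, so maximality forces \<open>?H = \<F>\<close>. Applied to the open
  neighbourhoods of an adherent point, this makes the point a limit of the filter.\<close>

lemma maximal_open_filter_mem:
  assumes \<F>: "open_filter X \<F>"
    and max: "\<And>\<H>. open_filter X \<H> \<Longrightarrow> \<F> \<subseteq> \<H> \<Longrightarrow> \<H> = \<F>"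
    and V: "openin X V" and meets: "\<And>F. F \<in> \<F> \<Longrightarrow> V \<inter> F \<noteq> {}"
  shows "V \<in> \<F>"
proof -
  let ?H = "{G. openin X G \<and> (\<exists>F\<in>\<F>. V \<inter> F \<subseteq> G)}"
  have "V \<in> ?H"
    using V topspace_open_filter[OF \<F>] by blast
  moreover have "open_filter X ?H"
    unfolding open_filter_def
  proof (intro conjI ballI allI impI)
    show "?H \<noteq> {}" using \<open>V \<in> ?H\<close> by blast
  next
    fix G assume "G \<in> ?H"
    then show "openin X G" "G \<noteq> {}" using meets by blast+
  next
    fix G G' assume "G \<in> ?H" "G' \<in> ?H"
    then obtain F F' where "F \<in> \<F>" "F' \<in> \<F>" "V \<inter> F \<subseteq> G" "V \<inter> F' \<subseteq> G'"
      and op: "openin X G" "openin X G'" by blast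
    then have "V \<inter> (F \<inter> F') \<subseteq> G \<inter> G'" "F \<inter> F' \<in> \<F>"
      using Int_open_filter[OF \<F>] by blast+
    then show "G \<inter> G' \<in> ?H" using op by blast
  next
    fix G G' assume "G \<in> ?H" "openin X G' \<and> G \<subseteq> G'"
    then show "G' \<in> ?H" by blast
  qed
  moreover have "\<F> \<subseteq> ?H"
    using openin_open_filter[OF \<F>] by blast
  ultimately show ?thesis using max by blast
qed

section \<open>Open covers and adherence\<close>

text \<open>If no finite \<open>\<V>\<close> had closures covering the space, the open sets
  \<open>c \<V>\<close> would be nonempty and form a base of an open filter \<open>\<F>\<close>. An
  adherent point outside \<open>A\<close> would lie in some \<open>U\<close> of the cover, but
  \<open>U\<close> misses the member \<open>c {U}\<close> of \<open>\<F>\<close>; so the adherence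
  would be contained in \<open>A\<close>.\<close>

lemma finite_subcover_dense_if_adherence:
  assumes adh: "\<And>\<F>. open_filter X \<F> \<Longrightarrow> \<not> adherence X \<F> \<subseteq> A"
    and \<U>: "\<And>U. U \<in> \<U> \<Longrightarrow> openin X U" "topspace X - A \<subseteq> \<Union>\<U>"
  shows "\<exists>\<V>\<subseteq>\<U>. finite \<V> \<and> topspace X = (\<Union>V\<in>\<V>. X closure_of V)"
proof (rule ccontr)
  assume no_dense: "\<not> ?thesis"
  define c where "c \<V> = topspace X - (\<Union>V\<in>\<V>. X closure_of V)" for \<V>
  define \<F> where "\<F> = {G. openin X G \<and> (\<exists>\<V>\<subseteq>\<U>. finite \<V> \<and> c \<V> \<subseteq> G)}"
  have c_ne: "c \<V> \<noteq> {}" if "\<V> \<subseteq> \<U>" "finite \<V>" for \<V>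
    using no_dense that closure_of_subset_topspace unfolding c_def by (metis Diff_eq_empty_iff UN_least subset_antisym)
  have open_c: "openin X (c \<V>)" if "finite \<V>" for \<V>
    unfolding c_def using that by (intro openin_diff closedin_Union) auto
  have \<F>: "open_filter X \<F>"
    unfolding open_filter_def
  proof (intro conjI ballI allI impI)
    show "\<F> \<noteq> {}" unfolding \<F>_def c_def by blast
  next
    fix G assume "G \<in> \<F>"
    then show "openin X G" "G \<noteq> {}" using c_ne unfolding \<F>_def by blast+
  next
    fix G G' assume "G \<in> \<F>" "G' \<in> \<F>"
    then obtain \<V> \<V>' where "\<V> \<subseteq> \<U>" "finite \<V>" "c \<V> \<subseteq> G" "\<V>' \<subseteq> \<U>" "finite \<V>'" "c \<V>' \<subseteq> G'"
      and op: "openin X (G \<inter> G')" unfolding \<F>_def by blast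
    \<comment> \<open>The map \<open>c\<close> turns unions into intersections, so the union of the
      two finite families is the witness.\<close>
    then have "c (\<V> \<union> \<V>') \<subseteq> G \<inter> G'" "finite (\<V> \<union> \<V>')" "\<V> \<union> \<V>' \<subseteq> \<U>"
      unfolding c_def by auto
    then show "G \<inter> G' \<in> \<F>" using op unfolding \<F>_def by blast
  next
    fix G G' assume "G \<in> \<F>" "openin X G' \<and> G \<subseteq> G'"
    then show "G' \<in> \<F>" unfolding \<F>_def by blast
  qed
  have "adherence X \<F> \<subseteq> A"
  proof
    fix x assume x: "x \<in> adherence X \<F>"
    show "x \<in> A"
    proof (rule ccontr)
      assume "x \<notin> A"
      then obtain U where U: "U \<in> \<U>" "x \<in> U"
        using x \<U>(2) adherence_subset_topspace[OF \<F>] by blast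
      have "c {U} \<in> \<F>" using U(1) open_c[of "{U}"] unfolding \<F>_def by blast
      moreover have "U \<inter> c {U} = {}"
        using closure_of_subset[OF openin_subset[OF \<U>(1)[OF U(1)]]] unfolding c_def by blast
      ultimately show False using x U \<U>(1) unfolding in_adherence[OF \<F>] by blast
    qed
  qed
  then show False using adh \<F> by blast
qed

text \<open>A finite \<open>\<V>\<close> comes from finitely many members of \<open>\<F>\<close>,
  which have a common point. Each such member \<open>F\<close> is a neighbourhood of that point and
  misses the complement of its own closure, so the point lies in none of the closures of the sets in
  \<open>\<V>\<close>.\<close>

lemma adherence_complement_cover:
  assumes \<F>: "open_filter X \<F>"
    and \<V>: "\<V> \<subseteq> (\<lambda>F. topspace X - X closure_of F) ` \<F>" "finite \<V>"
  shows "topspace X \<noteq> (\<Union>V\<in>\<V>. X closure_of V)"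
proof
  assume cover: "topspace X = (\<Union>V\<in>\<V>. X closure_of V)"
  obtain \<G> where \<G>: "\<G> \<subseteq> \<F>" "finite \<G>" "\<V> = (\<lambda>F. topspace X - X closure_of F) ` \<G>"
    using finite_subset_image[OF \<V>(2,1)] by blast
  \<comment> \<open>This rules out an empty \<open>\<G>\<close>, for which
    \<open>\<Inter>\<G>\<close> would be the whole type: the empty family covers only the empty
    space, whereas a space with an open filter has a point.\<close>
  have "topspace X \<noteq> {}"
    using topspace_open_filter[OF \<F>] nonempty_open_filter[OF \<F>] by blast
  then have "\<G> \<noteq> {}" using cover \<G>(3) by (metis UN_empty image_empty)
  then have Int: "\<Inter>\<G> \<in> \<F>"
    using Inter_open_filter[OF \<F> \<G>(2)] \<G>(1) by simp
  obtain x where x: "x \<in> \<Inter>\<G>"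
    using nonempty_open_filter[OF \<F> Int] by blast
  have "x \<in> topspace X"
    using openin_subset[OF openin_open_filter[OF \<F> Int]] x by (rule subsetD)
  then have "x \<in> (\<Union>V\<in>\<V>. X closure_of V)"
    by (rule subsetD[OF equalityD1[OF cover]])
  then have "x \<in> (\<Union>F\<in>\<G>. X closure_of (topspace X - X closure_of F))"
    unfolding \<G>(3) image_image .
  then obtain F where F: "F \<in> \<G>" "x \<in> X closure_of (topspace X - X closure_of F)"
    by blast
  have "openin X F" using F(1) \<G>(1) openin_open_filter[OF \<F>] by blast
  then obtain y where "y \<in> F" "y \<in> topspace X - X closure_of F"
    using F x by (auto simp: in_closure_of)
  then show False
    using closure_of_subset[OF openin_subset[OF \<open>openin X F\<close>]] by blast
qed

section \<open>From large adherences to closedness in extensions\<close>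

text \<open>The type \<open>'b\<close> is arbitrary here, which is what later carries closedness
  over from one type of extensions to all others.\<close>

lemma closed_in_extensions_if_adherence:
  fixes X :: "'a topology"
  assumes n: "n \<ge> 2"
    and adh: "\<And>\<F>. open_filter X \<F> \<Longrightarrow> infinite (adherence X \<F>) \<or> card (adherence X \<F>) \<ge> n - 1"
  shows "closed_in_extensions TYPE('b) n X"
  unfolding closed_in_extensions_def
proof (intro allI impI)
  fix Y :: "'b topology" and e :: "'a \<Rightarrow> 'b"
  let ?S = "e ` topspace X"
  assume "extension X Y e \<and> n_Hausdorff_except n Y ?S"
  then have emb: "embedding_map X Y e" and dense: "Y closure_of ?S = topspace Y"
    and H: "n_Hausdorff_except n Y ?S" unfolding extension_def by auto
  have cont: "continuous_map X Y e" and inj: "inj_on e (topspace X)"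
    using emb by (auto simp: embedding_map_def continuous_map_in_subtopology
        dest: homeomorphic_imp_continuous_map homeomorphic_imp_injective_map)
  have sub: "?S \<subseteq> topspace Y" using cont by (rule continuous_map_image_subset_topspace)
  \<comment> \<open>The trace of \<open>U\<close> on \<open>X\<close>, pulled back along
    \<open>e\<close> because the copy of \<open>X\<close> may live in another type.\<close>
  define tr where "tr U = {x \<in> topspace X. e x \<in> U}" for U
  have open_tr: "openin X (tr U)" if "openin Y U" for U
    unfolding tr_def using cont that by (rule openin_continuous_map_preimage)
  show "closedin Y ?S"
  proof (rule ccontr)
    assume "\<not> closedin Y ?S"
    then obtain p where p: "p \<in> topspace Y" "p \<notin> ?S"
      using sub by (metis closedin_topspace subsetI subset_antisym)
    \<comment> \<open>The trace on \<open>X\<close> of the neighbourhoods of \<open>p\<close>;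
      density of the copy of \<open>X\<close> keeps its members nonempty.\<close>
    define \<F> where "\<F> = {G. openin X G \<and> (\<exists>U. openin Y U \<and> p \<in> U \<and> tr U \<subseteq> G)}"
    have tr_ne: "tr U \<noteq> {}" if "openin Y U" "p \<in> U" for U
    proof -
      have "p \<in> Y closure_of ?S" using p dense by simp
      then show ?thesis using that unfolding in_closure_of tr_def by blast
    qed
    have tr_mem: "tr U \<in> \<F>" if "openin Y U" "p \<in> U" for U
      using that open_tr unfolding \<F>_def by blast
    have "open_filter X \<F>"
      unfolding open_filter_def
    proof (intro conjI ballI allI impI)
      show "\<F> \<noteq> {}" using tr_mem[OF openin_topspace p(1)] by blast
    next
      fix G assume "G \<in> \<F>"
      then show "openin X G" "G \<noteq> {}" using tr_ne unfolding \<F>_def by blast+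
    next
      fix G G' assume "G \<in> \<F>" "G' \<in> \<F>"
      then obtain U U' where "openin Y (U \<inter> U')" "p \<in> U \<inter> U'" "tr U \<subseteq> G" "tr U' \<subseteq> G'"
        and op: "openin X (G \<inter> G')" unfolding \<F>_def by blast
      then have "tr (U \<inter> U') \<subseteq> G \<inter> G'" unfolding tr_def by blast
      then show "G \<inter> G' \<in> \<F>"
        using op \<open>openin Y (U \<inter> U')\<close> \<open>p \<in> U \<inter> U'\<close> unfolding \<F>_def by blast
    next
      fix G G' assume "G \<in> \<F>" "openin X G' \<and> G \<subseteq> G'"
      then show "G' \<in> \<F>" unfolding \<F>_def by blast
    qed
    then obtain \<G> where \<G>: "open_filter X \<G>" "\<F> \<subseteq> \<G>"
      and max: "\<And>\<H>. open_filter X \<H> \<Longrightarrow> \<G> \<subseteq> \<H> \<Longrightarrow> \<H> = \<G>"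
      using maximal_open_filter_exists by blast
    \<comment> \<open>An infinite adherence also has a subset of exactly \<open>n - 1\<close>
      points. The images of these points under \<open>e\<close> will be the points
      \<open>q i\<close> of the separation property.\<close>
    obtain B where B: "B \<subseteq> adherence X \<G>" "finite B" "card B = n - 1"
      using adh[OF \<G>(1)] by (metis infinite_arbitrarily_large obtain_subset_with_card_n)
    then obtain f where f: "bij_betw f {1..n-1} B"
      using finite_same_card_bij[of "{1..n-1}" B] by auto
    then have f_adh: "f i \<in> adherence X \<G>" if "i \<in> {1..n-1}" for i
      using B(1) that bij_betwE by blast
    then have f_top: "f i \<in> topspace X" if "i \<in> {1..n-1}" for i
      using that adherence_subset_topspace[OF \<G>(1)] by blast
    have "inj_on (e \<circ> f) {1..n-1}"
      using f inj f_top by (intro comp_inj_on) (auto simp: bij_betw_def intro: inj_on_subset)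
    moreover have "\<forall>i\<in>{1..n-1}. (e \<circ> f) i \<in> topspace Y \<and> (e \<circ> f) i \<noteq> p"
      using p(2) f_top sub unfolding comp_def by blast
    ultimately obtain U V where UV: "openin Y U" "p \<in> U"
        "\<And>i. i \<in> {1..n-1} \<Longrightarrow> openin Y (V i) \<and> (e \<circ> f) i \<in> V i"
        "U \<inter> (\<Inter>i\<in>{1..n-1}. V i) = {}"
      using H p unfolding n_Hausdorff_except_def by (metis DiffI)
    \<comment> \<open>The trace of \<open>V i\<close> is an open neighbourhood of the adherent point
      \<open>f i\<close>, so it meets every member of \<open>\<G>\<close>, and maximality puts it
      into \<open>\<G>\<close>.\<close>
    have "tr (V i) \<in> \<G>" if i: "i \<in> {1..n-1}" for i
    proof (rule maximal_open_filter_mem[OF \<G>(1) max])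
      show "openin X (tr (V i))" using UV(3)[OF i] open_tr by blast
      fix F assume "F \<in> \<G>"
      moreover have "f i \<in> tr (V i)" using UV(3)[OF i] f_top[OF i] unfolding tr_def by simp
      ultimately show "tr (V i) \<inter> F \<noteq> {}"
        using f_adh[OF i] \<open>openin X (tr (V i))\<close> unfolding in_adherence[OF \<G>(1)] by blast
    qed
    \<comment> \<open>From \<open>n \<ge> 2\<close> the index set is nonempty, as the closure of
      \<open>\<G>\<close> under finite intersections requires.\<close>
    then have "(\<Inter>i\<in>{1..n-1}. tr (V i)) \<in> \<G>"
      using n by (intro Inter_open_filter[OF \<G>(1)]) auto
    then have "tr U \<inter> (\<Inter>i\<in>{1..n-1}. tr (V i)) \<noteq> {}"
      using tr_mem[OF UV(1,2)] \<G> Int_open_filter nonempty_open_filter by blast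
    then show False using UV(4) unfolding tr_def by blast
  qed
qed

section \<open>One-point extensions determined by an open filter\<close>

text \<open>For an open filter \<open>\<F>\<close>, the new point is \<open>None\<close>, its basic
  neighbourhoods are \<open>{None}\<close> joined with a copy of a member of \<open>\<F>\<close>,
  and the copy of \<open>X\<close> is an open subspace.\<close>

definition point_extension :: "'a topology \<Rightarrow> 'a set set \<Rightarrow> 'a option topology" where
  "point_extension X \<F> =
     topology (\<lambda>S. openin X (Some -` S) \<and> (None \<in> S \<longrightarrow> Some -` S \<in> \<F>))"

lemma openin_point_extension:
  assumes \<F>: "open_filter X \<F>"
  shows "openin (point_extension X \<F>) S \<longleftrightarrow>
    openin X (Some -` S) \<and> (None \<in> S \<longrightarrow> Some -` S \<in> \<F>)"
proof -
  have "istopology (\<lambda>S. openin X (Some -` S) \<and> (None \<in> S \<longrightarrow> Some -` S \<in> \<F>))"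
    unfolding istopology_def
  proof (intro conjI allI impI)
    fix S T
    assume "openin X (Some -` S) \<and> (None \<in> S \<longrightarrow> Some -` S \<in> \<F>)"
      "openin X (Some -` T) \<and> (None \<in> T \<longrightarrow> Some -` T \<in> \<F>)"
    then show "openin X (Some -` (S \<inter> T))" "None \<in> S \<inter> T \<Longrightarrow> Some -` (S \<inter> T) \<in> \<F>"
      using Int_open_filter[OF \<F>] by (auto simp: vimage_Int)
  next
    fix \<K> assume \<K>: "\<forall>K\<in>\<K>. openin X (Some -` K) \<and> (None \<in> K \<longrightarrow> Some -` K \<in> \<F>)"
    then show op: "openin X (Some -` \<Union>\<K>)" by (auto simp: vimage_Union)
    \<comment> \<open>A single \<open>K\<close> containing \<open>None\<close> suffices: its trace
      is in \<open>\<F>\<close>, and upward closure passes to the union.\<close>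
    assume "None \<in> \<Union>\<K>"
    then obtain K where "K \<in> \<K>" "Some -` K \<in> \<F>" using \<K> by blast
    then show "Some -` \<Union>\<K> \<in> \<F>"
      by (intro superset_open_filter[OF \<F> _ op]) auto
  qed
  then show ?thesis unfolding point_extension_def by (simp add: topology_inverse')
qed

lemma topspace_point_extension:
  assumes \<F>: "open_filter X \<F>"
  shows "topspace (point_extension X \<F>) = insert None (Some ` topspace X)"
proof (rule subset_antisym)
  have "openin X (Some -` topspace (point_extension X \<F>))"
    using openin_topspace openin_point_extension[OF \<F>] by blast
  then have "Some -` topspace (point_extension X \<F>) \<subseteq> topspace X" by (rule openin_subset)
  moreover have "a \<in> insert None (Some ` topspace X)"
    if "Some -` S \<subseteq> topspace X" "a \<in> S" for S and a :: "'a option"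
    using that by (cases a) auto
  ultimately show "topspace (point_extension X \<F>) \<subseteq> insert None (Some ` topspace X)" by blast
  have "Some -` insert None (Some ` topspace X) = topspace X" by auto
  then show "insert None (Some ` topspace X) \<subseteq> topspace (point_extension X \<F>)"
    using topspace_open_filter[OF \<F>] by (intro openin_subset) (simp add: openin_point_extension[OF \<F>])
qed

text \<open>\<open>Some\<close> is an injective, continuous and open map, hence an embedding. Its
  image is dense because an open set around \<open>None\<close> has its trace in
  \<open>\<F>\<close>, and members of \<open>\<F>\<close> are nonempty.\<close>

lemma extension_point_extension:
  assumes \<F>: "open_filter X \<F>"
  shows "extension X (point_extension X \<F>) Some"
  unfolding extension_def
proof
  let ?Y = "point_extension X \<F>"
  have "Some -` Some ` U = U" for U :: "'a set" by auto
  then have "open_map X ?Y Some"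
    unfolding open_map_def by (auto simp: openin_point_extension[OF \<F>])
  moreover have "{x \<in> topspace X. Some x \<in> S} = Some -` S" if "openin ?Y S" for S
    using that openin_subset unfolding openin_point_extension[OF \<F>] by fastforce
  then have "continuous_map X ?Y Some"
    by (auto simp: continuous_map topspace_point_extension[OF \<F>] openin_point_extension[OF \<F>])
  ultimately show "embedding_map X ?Y Some"
    by (intro injective_open_imp_embedding_map) auto
  have "\<exists>y. y \<in> Some ` topspace X \<and> y \<in> T" if "openin ?Y T" "t \<in> T" for T t
  proof -
    have "Some -` T \<noteq> {}" "Some -` T \<subseteq> topspace X"
      using that nonempty_open_filter[OF \<F>] openin_subset
      unfolding openin_point_extension[OF \<F>] by (cases t; blast)+
    then show ?thesis by blast
  qed
  then show "?Y closure_of (Some ` topspace X) = topspace ?Y"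
    by (auto simp: closure_of_def)
qed

text \<open>Otherwise \<open>{None}\<close> would be open; its trace is empty, and the empty set
  belongs to no open filter.\<close>

lemma not_closedin_point_extension:
  assumes \<F>: "open_filter X \<F>"
  shows "\<not> closedin (point_extension X \<F>) (Some ` topspace X)"
proof
  assume "closedin (point_extension X \<F>) (Some ` topspace X)"
  then have "openin (point_extension X \<F>) (insert None (Some ` topspace X) - Some ` topspace X)"
    using topspace_point_extension[OF \<F>] by (metis closedin_def)
  moreover have "insert None (Some ` topspace X) - Some ` topspace X = {None}" by auto
  ultimately have "Some -` {None} \<in> \<F>" by (simp add: openin_point_extension[OF \<F>])
  then show False using nonempty_open_filter[OF \<F>] by fastforce
qed

text \<open>The only point outside the copy of \<open>X\<close> is \<open>None\<close>. Since
  \<open>n - 1\<close> distinct points do not fit into the adherence, some \<open>q j\<close> is not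
  adherent, and a neighbourhood \<open>W\<close> of it misses a member \<open>F\<close> of
  \<open>\<F>\<close>. This pair already gives an empty intersection.\<close>

lemma n_Hausdorff_except_point_extension:
  assumes \<F>: "open_filter X \<F>"
    and fin: "finite (adherence X \<F>)" and card: "card (adherence X \<F>) < n - 1"
  shows "n_Hausdorff_except n (point_extension X \<F>) (Some ` topspace X)"
  unfolding n_Hausdorff_except_def
proof (intro allI impI, elim conjE)
  let ?Y = "point_extension X \<F>"
  fix p q
  assume p: "p \<in> topspace ?Y - Some ` topspace X"
    and q: "\<forall>i\<in>{1..n-1}. q i \<in> topspace ?Y \<and> q i \<noteq> p" and inj: "inj_on q {1..n-1}"
  have p_None: "p = None" using p topspace_point_extension[OF \<F>] by auto
  have "\<not> q ` {1..n-1} \<subseteq> Some ` adherence X \<F>"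
  proof
    assume "q ` {1..n-1} \<subseteq> Some ` adherence X \<F>"
    then have "card (q ` {1..n-1}) \<le> card (Some ` adherence X \<F>)" using fin by (intro card_mono) auto
    then show False using card card_image[OF inj] card_image_le[OF fin, of Some] by simp
  qed
  then obtain j where j: "j \<in> {1..n-1}" "q j \<notin> Some ` adherence X \<F>" by blast
  then obtain x where x: "q j = Some x" "x \<in> topspace X"
    using q p_None topspace_point_extension[OF \<F>] by (metis imageE insertE)
  then obtain W F where WF: "openin X W" "x \<in> W" "F \<in> \<F>" "W \<inter> F = {}"
    using j(2) in_adherence[OF \<F>, of x] by blast
  have vim: "Some -` insert None (Some ` F) = F" "Some -` Some ` W = W" by auto
  \<comment> \<open>Only the index \<open>j\<close> needs a small neighbourhood; the others get the
    whole space.\<close>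
  define V where "V i = (if i = j then Some ` W else topspace ?Y)" for i
  have "openin ?Y (insert None (Some ` F))"
    using WF openin_open_filter[OF \<F>] by (simp only: openin_point_extension[OF \<F>] vim) simp
  moreover have "openin ?Y (Some ` W)"
    using WF by (simp only: openin_point_extension[OF \<F>] vim) auto
  then have "\<forall>i\<in>{1..n-1}. openin ?Y (V i) \<and> q i \<in> V i"
    using q x(1) WF(2) unfolding V_def by simp
  moreover have "insert None (Some ` F) \<inter> (\<Inter>i\<in>{1..n-1}. V i) = {}"
  proof -
    have "(\<Inter>i\<in>{1..n-1}. V i) \<subseteq> V j" using j(1) by blast
    moreover have "insert None (Some ` F) \<inter> V j = {}" using WF(4) unfolding V_def by auto
    ultimately show ?thesis by blast
  qed
  ultimately show "\<exists>U V. openin ?Y U \<and> p \<in> U \<and> (\<forall>i\<in>{1..n-1}. openin ?Y (V i) \<and> q i \<in> V i) \<and>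
      U \<inter> (\<Inter>i\<in>{1..n-1}. V i) = {}"
    unfolding p_None by blast
qed

text \<open>As \<open>card\<close> is 0 on infinite sets, (a) lists the infinite case separately and
  (b) demands that \<open>A\<close> be finite. The passage from \<open>'a option\<close> to
  \<open>'b\<close> goes through \<open>cond_a\<close>, which mentions no extension.\<close>

theorem theorem2:
  fixes X :: "'a topology" and n :: nat
  assumes "n \<ge> 2"
  defines "cond_a \<equiv> (\<forall>\<F>. open_filter X \<F> \<longrightarrow>
             infinite (adherence X \<F>) \<or> card (adherence X \<F>) \<ge> n - 1)"
      and "cond_b \<equiv> (\<forall>A \<U>. A \<subseteq> topspace X \<and> finite A \<and> card A < n - 1 \<and>
             (\<forall>U\<in>\<U>. openin X U) \<and> topspace X - A \<subseteq> \<Union>\<U> \<longrightarrow>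
             (\<exists>\<V>. \<V> \<subseteq> \<U> \<and> finite \<V> \<and> topspace X = (\<Union>V\<in>\<V>. X closure_of V)))"
  shows "(cond_a \<longleftrightarrow> cond_b) \<and>
         (cond_b \<longleftrightarrow> closed_in_extensions TYPE('a option) n X) \<and>
         (closed_in_extensions TYPE('a option) n X \<longrightarrow> closed_in_extensions TYPE('b) n X)"
proof -
  have "cond_b" if a: "cond_a"
    unfolding cond_b_def
  proof (intro allI impI, elim conjE)
    fix A \<U>
    assume A: "finite A" "card A < n - 1"
      and \<U>: "\<forall>U\<in>\<U>. openin X U" "topspace X - A \<subseteq> \<Union>\<U>"
    \<comment> \<open>An adherence inside \<open>A\<close> would be finite with fewer than
      \<open>n - 1\<close> points.\<close>
    have "\<not> adherence X \<F> \<subseteq> A" if "open_filter X \<F>" for \<F>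
      using a that A card_mono[of A "adherence X \<F>"] finite_subset[of "adherence X \<F>" A]
      unfolding cond_a_def by (meson leD order_trans)
    then show "\<exists>\<V>. \<V> \<subseteq> \<U> \<and> finite \<V> \<and> topspace X = (\<Union>V\<in>\<V>. X closure_of V)"
      using \<U> by (intro finite_subcover_dense_if_adherence) auto
  qed
  moreover have "cond_a" if b: "cond_b"
    unfolding cond_a_def
  proof (intro allI impI, rule ccontr)
    fix \<F> assume \<F>: "open_filter X \<F>"
      and small: "\<not> (infinite (adherence X \<F>) \<or> n - 1 \<le> card (adherence X \<F>))"
    \<comment> \<open>The set \<open>A\<close> of (b) is taken to be the adherence itself; the
      complements of the closures cover exactly the rest of the space.\<close>
    let ?U = "(\<lambda>F. topspace X - X closure_of F) ` \<F>"
    have "topspace X - adherence X \<F> \<subseteq> \<Union>?U" "\<forall>U\<in>?U. openin X U"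
      unfolding adherence_def by (auto intro: openin_diff)
    then have "\<exists>\<V>\<subseteq>?U. finite \<V> \<and> topspace X = (\<Union>V\<in>\<V>. X closure_of V)"
      using b[unfolded cond_b_def, rule_format, of "adherence X \<F>" ?U] small
        adherence_subset_topspace[OF \<F>] by auto
    then show False using adherence_complement_cover[OF \<F>] by blast
  qed
  moreover have "cond_a" if c: "closed_in_extensions TYPE('a option) n X"
    unfolding cond_a_def
  proof (intro allI impI, rule ccontr)
    fix \<F> assume \<F>: "open_filter X \<F>"
      and "\<not> (infinite (adherence X \<F>) \<or> n - 1 \<le> card (adherence X \<F>))"
    then have "n_Hausdorff_except n (point_extension X \<F>) (Some ` topspace X)"
      by (intro n_Hausdorff_except_point_extension) auto
    then show False
      using c extension_point_extension[OF \<F>] not_closedin_point_extension[OF \<F>]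
      unfolding closed_in_extensions_def by blast
  qed
  moreover have "closed_in_extensions TYPE('a option) n X" "closed_in_extensions TYPE('b) n X"
    if "cond_a"
    using that assms(1) unfolding cond_a_def by (blast intro: closed_in_extensions_if_adherence)+
  ultimately show ?thesis by blast
qed

end
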